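(* Let $H: a_1x_1+\cdots+a_tx_t=b$ be a spanned hyperplane of $Q_n$ ($a_i,b$ positive integers, $a_1\le\cdots\le a_t$) of type $\alpha=(\alpha_1,\dots,\alpha_\ell)$. Let $\pi=\pi_1\cdots\pi_\ell\in P(H)$, where $\pi_i$ has cycle type $\mu^i=\{1^{m_{i1}},2^{m_{i2}},\ldots\}$ for $1\le i\le\ell$, and let $\psi(\pi)$ be the number of points of $V_t(H)$ fixed by $\pi$. Then $$\psi(\pi)=\begin{cases}[x^b]\prod_{i=1}^\ell\prod_{j\ge1}(1+x^{ij})^{m_{ij}}, & \text{if }\pi\in S_\alpha,\\ \chi(\mu)\,2^{\ell(\mu)}, & \text{if }\pi\in\overline{S}_\alpha,\end{cases}$$ where $\mu=\mu^1\cup\cdots\cup\mu^\ell$, $\ell(\mu)$ is the number of parts of $\mu$, and $\chi(\mu)=1$ if $\mu$ has no odd part and $\chi(\mu)=0$ otherwise.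
   Context: $Q_n=[0,1]^n$, $V_n=\{0,1\}^n$; a spanned hyperplane of $Q_n$ is a hyperplane whose intersection with $V_n$ has affine hull equal to it. Signed permutations of $\{1,\dots,t\}$ (underlying permutation $\sigma$, sign $\pm$ on each element) act on $\mathbb{R}^t$ by $w(x)_i=x_{\sigma(i)}$ (sign $+$) or $1-x_{\sigma(i)}$ (sign $-$). Type: $\ell=a_t$, $\alpha_i=\#\{j:a_j=i\}$, blocks $I_i=\{j:a_j=i\}$. $S_\alpha$: permutations of $\{1,\dots,t\}$ preserving each $I_i$ (all signs $+$); $\overline{S}_\alpha$: signed permutations with underlying permutation in $S_\alpha$ and all signs $-$; $P(H)=S_\alpha$ if $\sum a_i\ne2b$, $P(H)=S_\alpha\cup\overline{S}_\alpha$ if $\sum a_i=2b$. $\pi_i$ denotes the restriction of $\pi$ to $I_i$, whose cycle type is that of its underlying permutation ($m_{ij}$ cycles of length $j$). $V_t(H)=\{x\in\{0,1\}^t:\sum a_jx_j=b\}$. $\mu^1\cup\cdots\cup\mu^\ell$ is the partition formed by all parts of all $\mu^i$. $[x^b]$ denotes the coefficient of $x^b$. *)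

theory Defs
  imports "HOL-Analysis.Analysis" "HOL-Combinatorics.Combinatorics"
    "HOL-Computational_Algebra.Polynomial"
begin

definition cube_vertices :: "(real ^ 'n) set" where
  "cube_vertices = {x. \<forall>k. x $ k \<in> {0, 1}}"

definition is_hyperplane :: "(real ^ 'n) set \<Rightarrow> bool" where
  "is_hyperplane H \<longleftrightarrow> (\<exists>c d. c \<noteq> 0 \<and> H = {x. c \<bullet> x = d})"

definition spanned_hyperplane :: "(real ^ 'n) set \<Rightarrow> bool" where
  "spanned_hyperplane H \<longleftrightarrow> is_hyperplane H \<and> affine hull (H \<inter> cube_vertices) = H"

text \<open>
  The hyperplane \<open>a 1 * x_1 + \<dots> + a t * x_t = b\<close> of \<open>n\<close>-space with \<open>n = CARD('n)\<close>. The numbering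
  \<open>e\<close> of the index type is meant to be a bijection from \<open>{1..n}\<close>; the coordinates
  \<open>x_(t+1), \<dots>, x_n\<close> have coefficient 0.
\<close>
definition hyperplane_of :: "(nat \<Rightarrow> 'n) \<Rightarrow> nat \<Rightarrow> (nat \<Rightarrow> nat) \<Rightarrow> nat \<Rightarrow> (real ^ 'n) set" where
  "hyperplane_of e t a b = {x. (\<Sum>j=1..t. real (a j) * x $ e j) = real b}"

definition block :: "nat \<Rightarrow> (nat \<Rightarrow> nat) \<Rightarrow> nat \<Rightarrow> nat set" where
  "block t a i = {j \<in> {1..t}. a j = i}"

text \<open>
  For \<open>a 1 \<le> \<dots> \<le> a t\<close>, the list \<open>[\<alpha>_1, \<dots>, \<alpha>_l]\<close> with \<open>l = a t\<close>; entries may be 0.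
\<close>
definition hyperplane_type :: "nat \<Rightarrow> (nat \<Rightarrow> nat) \<Rightarrow> nat list" where
  "hyperplane_type t a = map (\<lambda>i. card (block t a i)) [1..<Suc (a t)]"

text \<open>
  Points of \<open>t\<close>-space, for the number \<open>t \<le> n\<close> that is not a type, are extensional functions on
  \<open>{1..t}\<close>.
\<close>
definition hyperplane_vertices :: "nat \<Rightarrow> (nat \<Rightarrow> nat) \<Rightarrow> nat \<Rightarrow> (nat \<Rightarrow> real) set" where
  "hyperplane_vertices t a b =
     {x \<in> {1..t} \<rightarrow>\<^sub>E {0, 1}. (\<Sum>j=1..t. real (a j) * x j) = real b}"

text \<open>
  A signed permutation is a pair of the underlying permutation and the sign function with values
  \<open>1\<close> and \<open>-1\<close>, extensional so that it is determined by the signs of \<open>1, \<dots>, t\<close>.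
\<close>
type_synonym signed_perm = "(nat \<Rightarrow> nat) \<times> (nat \<Rightarrow> int)"

definition signed_perms :: "nat \<Rightarrow> signed_perm set" where
  "signed_perms t = {(\<sigma>, s). \<sigma> permutes {1..t} \<and> s \<in> {1..t} \<rightarrow>\<^sub>E {1, -1}}"

definition signed_act :: "nat \<Rightarrow> signed_perm \<Rightarrow> (nat \<Rightarrow> real) \<Rightarrow> (nat \<Rightarrow> real)" where
  "signed_act t w x =
     (\<lambda>i\<in>{1..t}. if snd w i = 1 then x (fst w i) else 1 - x (fst w i))"

definition S_block :: "nat \<Rightarrow> (nat \<Rightarrow> nat) \<Rightarrow> signed_perm set" where
  "S_block t a = {w \<in> signed_perms t.
     (\<forall>i\<in>{1..a t}. fst w ` block t a i = block t a i) \<and> (\<forall>j\<in>{1..t}. snd w j = 1)}"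

definition S_block_neg :: "nat \<Rightarrow> (nat \<Rightarrow> nat) \<Rightarrow> signed_perm set" where
  "S_block_neg t a = {w \<in> signed_perms t.
     (\<forall>i\<in>{1..a t}. fst w ` block t a i = block t a i) \<and> (\<forall>j\<in>{1..t}. snd w j = -1)}"

definition hyperplane_group :: "nat \<Rightarrow> (nat \<Rightarrow> nat) \<Rightarrow> nat \<Rightarrow> signed_perm set" where
  "hyperplane_group t a b =
     (if (\<Sum>j=1..t. a j) = 2 * b then S_block t a \<union> S_block_neg t a else S_block t a)"

definition num_fixed :: "nat \<Rightarrow> (nat \<Rightarrow> nat) \<Rightarrow> nat \<Rightarrow> signed_perm \<Rightarrow> nat" where
  "num_fixed t a b w = card {x \<in> hyperplane_vertices t a b. signed_act t w x = x}"

definition signed_restrict :: "signed_perm \<Rightarrow> nat set \<Rightarrow> signed_perm" where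
  "signed_restrict w A = (perm_restrict (fst w) A, restrict (snd w) A)"

text \<open>
  The multiset of cycle lengths, fixed points included, of the underlying permutation of a signed
  permutation of a finite set \<open>A\<close>.
\<close>
definition cycle_type :: "nat set \<Rightarrow> signed_perm \<Rightarrow> nat multiset" where
  "cycle_type A w = image_mset card (mset_set (orbit (fst w) ` A))"

definition no_odd_part :: "nat multiset \<Rightarrow> nat" where
  "no_odd_part \<mu> = (if \<exists>p\<in>#\<mu>. odd p then 0 else 1)"

end

theory Submission
  imports Defs
begin

text \<open>
  Identify a 0/1 point with its support \<open>A \<subseteq> {1..t}\<close>. With all signs positive the point is fixed
  iff \<open>A\<close> is a union of cycles, and a cycle of length \<open>j\<close> inside \<open>I_i\<close> contributes \<open>i * j\<close> to the
  left-hand side of the equation. With all signs negative it is fixed iff membership in \<open>A\<close>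
  alternates along every cycle. Then all cycles are even, the two choices on each cycle are
  independent, and \<open>\<Sum> a_j x_j = b\<close> holds automatically because the permutation exchanges \<open>A\<close> with
  its complement and preserves the \<open>a_j\<close>, whose sum is \<open>2 b\<close>.
\<close>

section \<open>Cycles of a permutation and the sets invariant under it\<close>

lemma orbits_disjoint:
  assumes "f permutes S" "finite S" "C \<in> orbit f ` S" "D \<in> orbit f ` S" "C \<noteq> D"
  shows "C \<inter> D = {}"
proof -
  have "orbit f y = E" if "E \<in> orbit f ` S" "y \<in> E" for E y
    using that orbit_cyclic_eq3[OF cyclic_on_orbit[OF assms(1,2)]] by auto
  then show ?thesis using assms(3-5) by blast
qed

lemma self_in_orbit_permutes:
  assumes "f permutes S" "finite S"
  shows "x \<in> orbit f x"
  using assms by (intro permutation_self_in_orbit) (auto simp: permutation_permutes)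

text \<open>On a finite set every orbit is a cycle and is determined by any of its points. An
  invariant set therefore contains each cycle that it meets, and collecting the orbits of its points
  recovers the chosen cycles.\<close>

lemma bij_betw_Union_orbits:
  assumes "f permutes S" "finite S"
  shows "bij_betw Union (Pow (orbit f ` S)) {A. A \<subseteq> S \<and> (\<forall>j\<in>S. f j \<in> A \<longleftrightarrow> j \<in> A)}"
proof (rule bij_betw_byWitness[where f' = "\<lambda>A. orbit f ` A"])
  have closed: "orbit f x \<subseteq> A" if "A \<subseteq> S" "\<forall>j\<in>S. f j \<in> A \<longleftrightarrow> j \<in> A" "x \<in> A" for A x
  proof
    fix y assume "y \<in> orbit f x"
    then show "y \<in> A" by induction (use that in auto)
  qed
  show "\<forall>Q\<in>Pow (orbit f ` S). orbit f ` \<Union>Q = Q"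
  proof
    fix Q assume Q: "Q \<in> Pow (orbit f ` S)"
    have eq: "orbit f y = C" if "C \<in> Q" "y \<in> C" for C y
      using Q that orbit_cyclic_eq3[OF cyclic_on_orbit[OF assms]] by auto
    show "orbit f ` \<Union>Q = Q"
    proof (intro equalityI subsetI)
      fix C assume "C \<in> Q"
      moreover obtain x where "C = orbit f x" using Q \<open>C \<in> Q\<close> by blast
      \<comment> \<open>The witness is \<open>f x\<close> because \<open>orbit\<close> is generated
        from the image of its starting point, so that \<open>f x\<close> lies in \<open>C\<close> by
        the base rule.\<close>
      ultimately show "C \<in> orbit f ` \<Union>Q"
        using orbit.base[of f x] eq by (intro image_eqI[of _ _ "f x"]) auto
    qed (use eq in auto)
  qed
  show "\<forall>A\<in>{A. A \<subseteq> S \<and> (\<forall>j\<in>S. f j \<in> A \<longleftrightarrow> j \<in> A)}. \<Union>(orbit f ` A) = A"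
  proof (intro ballI equalityI)
    fix A assume "A \<in> {A. A \<subseteq> S \<and> (\<forall>j\<in>S. f j \<in> A \<longleftrightarrow> j \<in> A)}"
    then show "\<Union>(orbit f ` A) \<subseteq> A" using closed by (intro UN_least) auto
  qed (use self_in_orbit_permutes[OF assms] in auto)
  show "Union ` Pow (orbit f ` S) \<subseteq> {A. A \<subseteq> S \<and> (\<forall>j\<in>S. f j \<in> A \<longleftrightarrow> j \<in> A)}"
  proof clarify
    fix Q assume Q: "Q \<subseteq> orbit f ` S"
    have "f j \<in> C \<longleftrightarrow> j \<in> C" if "C \<in> Q" for C j
    proof -
      obtain x where "C = orbit f x" using Q \<open>C \<in> Q\<close> by blast
      then show ?thesis
        using cyclic_on_f_in[OF assms(1) cyclic_on_orbit[OF assms]] orbit.step[of j f x] by blast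
    qed
    moreover have "\<Union>Q \<subseteq> S"
      using Q permutes_orbit_subset[OF assms(1)] by (intro Union_least) auto
    ultimately show "\<Union>Q \<subseteq> S \<and> (\<forall>j\<in>S. f j \<in> \<Union>Q \<longleftrightarrow> j \<in> \<Union>Q)"
      by blast
  qed
  show "(\<lambda>A. orbit f ` A) ` {A. A \<subseteq> S \<and> (\<forall>j\<in>S. f j \<in> A \<longleftrightarrow> j \<in> A)} \<subseteq> Pow (orbit f ` S)"
    by auto
qed

section \<open>Sets that alternate along the cycles\<close>

lemma card_orbit_conv_funpow_dist1:
  assumes "x \<in> orbit f x"
  shows "card (orbit f x) = funpow_dist1 f x x"
  by (subst orbit_conv_funpow_dist1[OF assms])
    (subst card_image[OF inj_on_funpow_dist1[OF assms]], simp)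

text \<open>Read \<open>funpow_dist f r j\<close> as the position of \<open>j\<close> on the cycle
  through \<open>r\<close>. Applying \<open>f\<close> raises it by one, except that the last
  position wraps to 0. In a cycle of even length the last position is odd, so the parity flips there
  too.\<close>

lemma parity_funpow_dist_step:
  assumes self: "r \<in> orbit f r" and j: "j \<in> orbit f r" and ev: "even (card (orbit f r))"
  shows "even (funpow_dist f r (f j)) \<longleftrightarrow> odd (funpow_dist f r j)"
proof -
  let ?N = "funpow_dist1 f r r"
  have N: "even ?N" "(f ^^ ?N) r = r"
    using ev card_orbit_conv_funpow_dist1[OF self] funpow_dist1_prop[OF self] by auto
  have lt: "funpow_dist f r y < ?N" if y: "y \<in> orbit f r" for y
  proof -
    obtain n where "n < ?N" "(f ^^ n) r = y"
      using y unfolding orbit_conv_funpow_dist1[OF self] by auto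
    then show ?thesis
      using funpow_dist_least by (meson le_less_trans not_less)
  qed
  have fj: "f j \<in> orbit f r" using j by (rule orbit.step)
  have step: "(f ^^ Suc (funpow_dist f r j)) r = f j"
    using funpow_dist_prop[OF j] by simp
  show ?thesis
  proof (cases "Suc (funpow_dist f r j) = ?N")
    case True
    then have "f j = r" using step N by metis
    then have "funpow_dist f r (f j) = 0" by (simp add: funpow_dist_0)
    moreover have "odd (funpow_dist f r j)" using N(1) unfolding True[symmetric] by simp
    ultimately show ?thesis by simp
  next
    case False
    then have "Suc (funpow_dist f r j) < ?N" using lt[OF j] by simp
    \<comment> \<open>Iterates of \<open>r\<close> with distinct exponents below the cycle length
      differ, so two such exponents that both lead to \<open>f j\<close> are equal.\<close>
    then have "funpow_dist f r (f j) = Suc (funpow_dist f r j)"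
      using funpow_neq_less_funpow_dist1[OF self lt[OF fj]] step funpow_dist_prop[OF fj] by metis
    then show ?thesis by simp
  qed
qed

text \<open>Going once round an odd cycle would flip membership an odd number of times. If all
  cycles are even, fix one alternating set: symmetric difference with it exchanges alternating and
  invariant sets, and the latter are the unions of cycles.\<close>

lemma card_alternating_sets:
  assumes "f permutes S" "finite S"
  shows "card {A. A \<subseteq> S \<and> (\<forall>j\<in>S. f j \<in> A \<longleftrightarrow> j \<notin> A)} =
    (if \<exists>C\<in>orbit f ` S. odd (card C) then 0 else 2 ^ card (orbit f ` S))"
proof (cases "\<exists>x\<in>S. odd (card (orbit f x))")
  case True
  then obtain x where x: "x \<in> S" "odd (card (orbit f x))" by blast
  have self: "x \<in> orbit f x" by (rule self_in_orbit_permutes[OF assms])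
  have "False" if A: "\<forall>j\<in>S. f j \<in> A \<longleftrightarrow> j \<notin> A" for A
  proof -
    have "(f ^^ n) x \<in> S \<and> ((f ^^ n) x \<in> A \<longleftrightarrow> (x \<in> A \<longleftrightarrow> even n))" for n
      by (induction n) (use A x permutes_in_image[OF assms(1)] in auto)
    from this[of "funpow_dist1 f x x"] show False
      using x(2) card_orbit_conv_funpow_dist1[OF self] funpow_dist1_prop[OF self] by metis
  qed
  then have "{A. A \<subseteq> S \<and> (\<forall>j\<in>S. f j \<in> A \<longleftrightarrow> j \<notin> A)} = {}" by blast
  then show ?thesis using True by (simp only: card.empty) simp
next
  case False
  \<comment> \<open>The choice sees only the set \<open>orbit f j\<close>, so all points of a cycle
    receive the same representative; this is what makes \<open>rf\<close> true.\<close>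
  define r where "r j = (SOME r. r \<in> orbit f j)" for j
  have r: "r j \<in> orbit f j" for j
    unfolding r_def using orbit_nonempty by (metis some_in_eq)
  have orb: "orbit f (r j) = orbit f j" for j
    using orbit_cyclic_eq3[OF cyclic_on_orbit[OF assms] r] .
  have rf: "r (f j) = r j" for j
    unfolding r_def
    using self_in_orbit_step[OF self_in_orbit_permutes[OF assms]] by metis
  \<comment> \<open>The reference set takes the even positions of each cycle, counted from its
    representative.\<close>
  define B where "B = {j \<in> S. even (funpow_dist f (r j) j)}"
  have B: "f j \<in> B \<longleftrightarrow> j \<notin> B" if "j \<in> S" for j
    using parity_funpow_dist_step[of "r j" f j] False that orb[of j] rf[of j] r[of j]
      self_in_orbit_permutes[OF assms, of j] permutes_in_image[OF assms(1), of j]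
    by (simp add: B_def)
  have BS: "B \<subseteq> S" by (auto simp: B_def)
  have "bij_betw (\<lambda>A. sym_diff A B) {A. A \<subseteq> S \<and> (\<forall>j\<in>S. f j \<in> A \<longleftrightarrow> j \<in> A)}
      {A. A \<subseteq> S \<and> (\<forall>j\<in>S. f j \<in> A \<longleftrightarrow> j \<notin> A)}"
    by (rule bij_betw_byWitness[where f' = "\<lambda>A. sym_diff A B"]) (use B BS in auto)
  from bij_betw_same_card[OF this]
  have "card {A. A \<subseteq> S \<and> (\<forall>j\<in>S. f j \<in> A \<longleftrightarrow> j \<notin> A)} = card (Pow (orbit f ` S))"
    by (simp only: bij_betw_same_card[OF bij_betw_Union_orbits[OF assms]])
  then show ?thesis using False assms(2) by (auto simp: card_Pow)
qed

section \<open>Product expansions over cycles, and fixed vertices as sets of indices\<close>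

lemma coeff_prod_one_plus_monom:
  fixes w :: "'a \<Rightarrow> nat"
  assumes "finite P"
  shows "coeff (\<Prod>C\<in>P. 1 + monom (1 :: 'b :: comm_semiring_1) (w C)) b =
    of_nat (card {Q. Q \<subseteq> P \<and> sum w Q = b})"
proof -
  have monom: "(\<Prod>C\<in>Q. monom (1 :: 'b) (w C)) = monom 1 (sum w Q)" if "finite Q" for Q
    using that by induction (auto simp: mult_monom)
  \<comment> \<open>\<open>prod_add\<close> sums over all subsets, using the first summand on the
    subset and the second off it. With the monomial put first, \<open>Q\<close> contributes
    \<open>monom 1 (sum w Q)\<close>.\<close>
  have "(\<Prod>C\<in>P. 1 + monom (1 :: 'b) (w C)) = (\<Prod>C\<in>P. monom 1 (w C) + 1)"
    by (simp add: add.commute)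
  also have "\<dots> = (\<Sum>Q\<in>Pow P. monom 1 (sum w Q))"
    unfolding prod_add[OF assms] using assms
    by (intro sum.cong refl) (auto simp: monom finite_subset)
  finally have "coeff (\<Prod>C\<in>P. 1 + monom (1 :: 'b) (w C)) b =
      (\<Sum>Q\<in>Pow P. of_bool (sum w Q = b))"
    by (simp add: coeff_sum of_bool_def)
  also have "\<dots> = of_nat (card (Pow P \<inter> {Q. sum w Q = b}))"
    using assms by simp
  also have "Pow P \<inter> {Q. sum w Q = b} = {Q. Q \<subseteq> P \<and> sum w Q = b}" by auto
  finally show ?thesis .
qed

text \<open>Members of \<open>P\<close> of equal cardinality give equal factors and are grouped.
  Values in \<open>J\<close> that are not attained have exponent 0, so any finite \<open>J\<close>
  containing the attained ones serves.\<close>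

lemma prod_power_count_image_card:
  fixes g :: "nat \<Rightarrow> 'b :: comm_monoid_mult"
  assumes "finite P" "card ` P \<subseteq> J" "finite J"
  shows "(\<Prod>j\<in>J. g j ^ count (image_mset card (mset_set P)) j) = (\<Prod>C\<in>P. g (card C))"
proof -
  have "(\<Prod>C\<in>P. g (card C)) = prod_mset (image_mset g (image_mset card (mset_set P)))"
    by (simp add: prod_unfold_prod_mset image_mset.compositionality comp_def)
  also have "\<dots> = (\<Prod>j\<in>card ` P. g j ^ count (image_mset card (mset_set P)) j)"
    unfolding image_prod_mset_multiplicity using assms(1) by simp
  also have "\<dots> = (\<Prod>j\<in>J. g j ^ count (image_mset card (mset_set P)) j)"
  proof (rule prod.mono_neutral_left[OF assms(3,2)], intro ballI)
    fix j assume "j \<in> J - card ` P"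
    then have "j \<notin># image_mset card (mset_set P)" using assms(1) by auto
    then have "count (image_mset card (mset_set P)) j = 0" by (simp only: not_in_iff)
    then show "g j ^ count (image_mset card (mset_set P)) j = 1" by simp
  qed
  finally show ?thesis ..
qed

text \<open>Both sign patterns are treated at once:
  \<open>j \<in> A \<longleftrightarrow> pos\<close> means membership for positive signs and
  non-membership for negative ones, matching \<open>x\<close> and \<open>1 - x\<close> at a 0/1
  coordinate.\<close>

lemma num_fixed_conv_card_sets:
  assumes "\<sigma> permutes {1..t}"
    and sign: "\<forall>j\<in>{1..t}. s j = (if pos then 1 else -1)"
  shows "num_fixed t a b (\<sigma>, s) =
    card {A. A \<subseteq> {1..t} \<and> (\<forall>j\<in>{1..t}. \<sigma> j \<in> A \<longleftrightarrow> (j \<in> A \<longleftrightarrow> pos)) \<and> sum a A = b}"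
    (is "_ = card ?R")
proof -
  let ?S = "{1..t}"
  let ?L = "{x \<in> hyperplane_vertices t a b. signed_act t (\<sigma>, s) x = x}"
  \<comment> \<open>The indicator is cut down to \<open>?S\<close> because points are extensional;
    otherwise \<open>inv\<close> would fail outside the index range.\<close>
  let ?x = "\<lambda>A. \<lambda>j\<in>?S. of_bool (j \<in> A) :: real"
  have img: "\<sigma> j \<in> ?S" if "j \<in> ?S" for j
    using that permutes_in_image[OF assms(1)] by blast
  have fixed: "signed_act t (\<sigma>, s) x = x \<longleftrightarrow>
      (\<forall>j\<in>?S. (if pos then x (\<sigma> j) else 1 - x (\<sigma> j)) = x j)"
    if "x \<in> ?S \<rightarrow>\<^sub>E {0, 1}" for x
    using that sign by (auto simp: signed_act_def fun_eq_iff PiE_def extensional_def)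
  have weight: "(\<Sum>j=1..t. real (a j) * ?x A j) = real (sum a A)" if "A \<subseteq> ?S" for A
  proof -
    have "(\<Sum>j=1..t. real (a j) * ?x A j) = (\<Sum>j\<in>?S. if j \<in> A then real (a j) else 0)"
      by (intro sum.cong) auto
    also have "\<dots> = sum (\<lambda>j. real (a j)) (?S \<inter> A)"
      by (simp add: sum.inter_restrict)
    finally show ?thesis using that by (simp add: Int_absorb1)
  qed
  have mem: "?x A \<in> ?L \<longleftrightarrow> A \<in> ?R" if A: "A \<subseteq> ?S" for A
  proof -
    have x: "?x A \<in> ?S \<rightarrow>\<^sub>E {0, 1}" by auto
    have "signed_act t (\<sigma>, s) (?x A) = ?x A \<longleftrightarrow> (\<forall>j\<in>?S. \<sigma> j \<in> A \<longleftrightarrow> (j \<in> A \<longleftrightarrow> pos))"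
      unfolding fixed[OF x] using img by (intro ball_cong refl) (auto simp del: atLeastAtMost_iff)
    then show ?thesis
      using A x weight[OF A] by (auto simp: hyperplane_vertices_def simp del: of_nat_sum)
  qed
  have inv: "?x {j\<in>?S. x j = 1} = x" if "x \<in> ?S \<rightarrow>\<^sub>E {0, 1}" for x
  proof
    fix j show "?x {j\<in>?S. x j = 1} j = x j"
      using that by (cases "j \<in> ?S") (auto simp: PiE_def extensional_def Pi_def)
  qed
  have "bij_betw ?x ?R ?L"
  proof (rule bij_betw_byWitness[where f' = "\<lambda>x. {j\<in>?S. x j = 1}"])
    show "\<forall>A\<in>?R. {j\<in>?S. ?x A j = 1} = A" by (auto simp: subset_iff)
    show "\<forall>x\<in>?L. ?x {j\<in>?S. x j = 1} = x"
      using inv unfolding hyperplane_vertices_def by blast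
    show "?x ` ?R \<subseteq> ?L" using mem by blast
    show "(\<lambda>x. {j\<in>?S. x j = 1}) ` ?L \<subseteq> ?R"
    proof (rule image_subsetI)
      fix x assume x: "x \<in> ?L"
      then have "?x {j\<in>?S. x j = 1} = x" using inv unfolding hyperplane_vertices_def by blast
      then have "?x {j\<in>?S. x j = 1} \<in> ?L" using x by simp
      then show "{j\<in>?S. x j = 1} \<in> ?R" using mem[of "{j\<in>?S. x j = 1}"] by blast
    qed
  qed
  from bij_betw_same_card[OF this] show ?thesis
    by (simp only: num_fixed_def)
qed

text \<open>The permutation carries \<open>S - A\<close> onto \<open>A\<close> without changing
  coefficients, so the two halves have equal weight.\<close>

lemma sum_alternating_set:
  fixes a :: "'a \<Rightarrow> nat"
  assumes "\<sigma> permutes S" "finite S" "\<forall>j\<in>S. a (\<sigma> j) = a j"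
    and A: "A \<subseteq> S" "\<forall>j\<in>S. \<sigma> j \<in> A \<longleftrightarrow> j \<notin> A"
  shows "sum a S = 2 * sum a A"
proof -
  have "\<sigma> ` (S - A) = A"
  proof
    show "\<sigma> ` (S - A) \<subseteq> A" using A by auto
    show "A \<subseteq> \<sigma> ` (S - A)"
    proof
      fix y assume "y \<in> A"
      then obtain x where "x \<in> S" "y = \<sigma> x"
        using A permutes_image[OF assms(1)] by blast
      then show "y \<in> \<sigma> ` (S - A)" using A \<open>y \<in> A\<close> by auto
    qed
  qed
  moreover have "inj_on \<sigma> (S - A)" using permutes_inj_on[OF assms(1)] .
  ultimately have "sum a A = sum (a \<circ> \<sigma>) (S - A)"
    by (metis sum.reindex)
  also have "\<dots> = sum a (S - A)" using assms(3) by (intro sum.cong) auto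
  finally show ?thesis
    using sum.subset_diff[OF A(1) assms(2), of a] by simp
qed

text \<open>Iteration from a point of \<open>A\<close> never leaves \<open>A\<close>, so restricting
  to \<open>A\<close> changes no orbit there. Hence all cycle types can be read off from the
  unrestricted permutation.\<close>

lemma cycle_type_signed_restrict:
  assumes "fst w ` A = A" "fst w permutes S" "finite S"
  shows "cycle_type A (signed_restrict w A) = image_mset card (mset_set (orbit (fst w) ` A))"
proof -
  have "orbit (perm_restrict (fst w) A) x = orbit (fst w) x" if "x \<in> A" for x
    using that assms(1) by (intro orbit_cong0[where A = A]) (auto simp: perm_restrict_def)
  then show ?thesis
    by (simp add: cycle_type_def signed_restrict_def cong: image_cong)
qed

section \<open>Counting the fixed vertices for the two sign patterns\<close>

theorem theorem6p4:
  fixes e :: "nat \<Rightarrow> 'n::finite"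
    and t b :: nat
    and a :: "nat \<Rightarrow> nat"
    and \<alpha> :: "nat list"
    and \<pi> :: signed_perm
    and \<mu>s :: "nat \<Rightarrow> nat multiset"
    and \<mu> :: "nat multiset"
  assumes "bij_betw e {1..CARD('n)} UNIV"
    and "1 \<le> t" and "t \<le> CARD('n)"
    and "\<forall>j\<in>{1..t}. 0 < a j" and "0 < b" and "mono_on {1..t} a"
    and "spanned_hyperplane (hyperplane_of e t a b)"
    and "\<alpha> = hyperplane_type t a"
    and "\<pi> \<in> hyperplane_group t a b"
    and "\<forall>i\<in>{1..length \<alpha>}.
           \<mu>s i = cycle_type (block t a i) (signed_restrict \<pi> (block t a i))"
    and "\<mu> = (\<Sum>i=1..length \<alpha>. \<mu>s i)"
  shows "(\<pi> \<in> S_block t a \<longrightarrow>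
            num_fixed t a b \<pi> =
              coeff (\<Prod>i=1..length \<alpha>. \<Prod>j=1..t. (1 + monom 1 (i * j)) ^ count (\<mu>s i) j) b) \<and>
         (\<pi> \<in> S_block_neg t a \<longrightarrow>
            num_fixed t a b \<pi> = no_odd_part \<mu> * 2 ^ size \<mu>)"
proof -
  let ?S = "{1..t}"
  obtain \<sigma> s where \<pi>: "\<pi> = (\<sigma>, s)" by (cases \<pi>)
  have len: "length \<alpha> = a t" using assms(8) by (simp add: hyperplane_type_def)
  have perm: "\<sigma> permutes ?S" and blocks: "\<forall>i\<in>{1..a t}. \<sigma> ` block t a i = block t a i"
    using assms(9) by (auto simp: \<pi> hyperplane_group_def S_block_def S_block_neg_def
        signed_perms_def split: if_splits)
  have fin: "finite ?S" by simp
  \<comment> \<open>By monotonicity the last coefficient \<open>a t\<close> bounds all others, so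
    the blocks with index in \<open>{1..a t}\<close>, some possibly empty, cover
    \<open>?S\<close>.\<close>
  have range: "a j \<in> {1..a t}" if "j \<in> ?S" for j
    using that assms(2,4) mono_onD[OF assms(6), of j t] by force
  have inv: "a (\<sigma> j) = a j" if "j \<in> ?S" for j
  proof -
    have "\<sigma> j \<in> block t a (a j)"
      using bspec[OF blocks range[OF that]] that unfolding block_def by blast
    then show ?thesis by (simp add: block_def)
  qed
  let ?P = "orbit \<sigma> ` ?S" and ?B = "\<lambda>i. orbit \<sigma> ` block t a i"
  have \<mu>s: "\<mu>s i = image_mset card (mset_set (?B i))" if "i \<in> {1..a t}" for i
    using assms(10) that len cycle_type_signed_restrict[of \<pi> "block t a i" ?S] perm blocks
    by (simp add: \<pi>)
  have finB: "finite (?B i)" for i by (simp add: block_def)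
  have P: "?P = (\<Union>i\<in>{1..a t}. ?B i)"
  proof -
    have "?S = (\<Union>i\<in>{1..a t}. block t a i)"
      using range unfolding block_def by blast
    then show ?thesis by (simp only: image_UN)
  qed
  \<comment> \<open>The coefficient is constant along a cycle. This separates the cycle families of
    different blocks, and later gives a cycle \<open>C\<close> of block \<open>i\<close> the weight
    \<open>i * card C\<close>.\<close>
  have orbit_a: "a y = i" if "C \<in> ?B i" "y \<in> C" for C y i
  proof -
    from that obtain x where "x \<in> ?S" "a x = i" "y \<in> orbit \<sigma> x" by (auto simp: block_def)
    from this(3) have "y \<in> ?S \<and> a y = i"
      by induction (use \<open>x \<in> ?S\<close> \<open>a x = i\<close> inv permutes_in_image[OF perm] in auto)
    then show ?thesis ..
  qed
  have disj: "?B i \<inter> ?B k = {}" if "i \<noteq> k" for i k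
  proof -
    have False if C: "C \<in> ?B i" "C \<in> ?B k" for C
    proof -
      obtain y where "y \<in> C" using C(1) orbit.base[of \<sigma>] by blast
      then show False using orbit_a[OF C(1)] orbit_a[OF C(2)] \<open>i \<noteq> k\<close> by simp
    qed
    then show ?thesis by blast
  qed
  show ?thesis
  proof (intro conjI impI)
    assume "\<pi> \<in> S_block t a"
    then have "num_fixed t a b \<pi> =
        card {A. A \<subseteq> ?S \<and> (\<forall>j\<in>?S. \<sigma> j \<in> A \<longleftrightarrow> j \<in> A) \<and> sum a A = b}"
      using num_fixed_conv_card_sets[OF perm, of s True a b] by (simp add: \<pi> S_block_def)
    also have "\<dots> = card {Q. Q \<subseteq> ?P \<and> sum (sum a) Q = b}"
    proof -
      \<comment> \<open>Distinct cycles are disjoint, so the weight of a union is the sum of the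
        weights; the count then runs over sets of cycles.\<close>
      have sum_eq: "sum a (\<Union>Q) = sum (sum a) Q" if "Q \<subseteq> ?P" for Q
      proof -
        have "finite C" if "C \<in> Q" for C
          using \<open>Q \<subseteq> ?P\<close> that finite_orbit[OF self_in_orbit_permutes[OF perm fin]] by blast
        moreover have "\<forall>C\<in>Q. \<forall>D\<in>Q. C \<noteq> D \<longrightarrow> C \<inter> D = {}"
          using \<open>Q \<subseteq> ?P\<close> orbits_disjoint[OF perm fin] by (metis subsetD)
        ultimately show ?thesis using sum.Union_disjoint[of Q a] by auto
      qed
      have "bij_betw Union {Q \<in> Pow ?P. sum (sum a) Q = b}
          {A \<in> {A. A \<subseteq> ?S \<and> (\<forall>j\<in>?S. \<sigma> j \<in> A \<longleftrightarrow> j \<in> A)}. sum a A = b}"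
        by (rule bij_betw_Collect[OF bij_betw_Union_orbits[OF perm fin]]) (simp add: sum_eq)
      then show ?thesis
        by (auto dest!: bij_betw_same_card simp: conj_assoc)
    qed
    \<comment> \<open>The polynomial has coefficients in \<open>nat\<close>, where
      \<open>of_nat\<close> is the identity, so its coefficient is the count itself.\<close>
    also have "\<dots> = coeff (\<Prod>C\<in>?P. 1 + monom 1 (sum a C)) b"
      by (subst coeff_prod_one_plus_monom) auto
    also have "(\<Prod>C\<in>?P. 1 + monom 1 (sum a C)) =
        (\<Prod>i=1..a t. \<Prod>C\<in>?B i. 1 + monom (1::nat) (sum a C))"
      unfolding P by (rule prod.UNION_disjoint) (use finB disj in auto)
    also have "\<dots> = (\<Prod>i=1..a t. \<Prod>j=1..t. (1 + monom 1 (i * j)) ^ count (\<mu>s i) j)"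
    proof (rule prod.cong[OF refl])
      fix i assume i: "i \<in> {1..a t}"
      \<comment> \<open>A cycle is a nonempty subset of \<open>{1..t}\<close>, so cutting the
        product over all \<open>j \<ge> 1\<close> at \<open>t\<close> loses no cycle length.\<close>
      have "card C \<in> {1..t}" if "C \<in> ?B i" for C
      proof -
        have "C \<subseteq> ?S" "C \<noteq> {}"
          using that permutes_orbit_subset[OF perm] orbit_nonempty[of \<sigma>]
          by (auto simp: block_def)
        then show ?thesis
          using card_mono[OF fin] card_gt_0_iff[of C] finite_subset[OF _ fin] by force
      qed
      then have "(\<Prod>j=1..t. (1 + monom (1::nat) (i * j)) ^ count (\<mu>s i) j) =
          (\<Prod>C\<in>?B i. 1 + monom 1 (i * card C))"
        unfolding \<mu>s[OF i] by (intro prod_power_count_image_card finB) auto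
      also have "\<dots> = (\<Prod>C\<in>?B i. 1 + monom 1 (sum a C))"
      proof (rule prod.cong[OF refl])
        fix C assume "C \<in> ?B i"
        then have "sum a C = (\<Sum>y\<in>C. i)" using orbit_a by (intro sum.cong) auto
        then show "1 + monom (1::nat) (i * card C) = 1 + monom 1 (sum a C)"
          by (simp add: mult.commute)
      qed
      finally show "(\<Prod>C\<in>?B i. 1 + monom (1::nat) (sum a C)) =
          (\<Prod>j=1..t. (1 + monom 1 (i * j)) ^ count (\<mu>s i) j)" ..
    qed
    finally show "num_fixed t a b \<pi> =
        coeff (\<Prod>i=1..length \<alpha>. \<Prod>j=1..t. (1 + monom 1 (i * j)) ^ count (\<mu>s i) j) b"
      by (simp add: len)
  next
    assume neg: "\<pi> \<in> S_block_neg t a"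
    then have sneg: "\<forall>j\<in>?S. s j = -1" by (simp add: \<pi> S_block_neg_def)
    \<comment> \<open>Since \<open>1 \<le> t\<close>, some sign is actually tested and \<pi> cannot
      also lie in \<open>S_block t a\<close>. Its membership in the group thus comes from the branch
      in which the coefficients sum to \<open>2 * b\<close>.\<close>
    then have "s t \<noteq> 1" using assms(2) by simp
    then have "\<pi> \<notin> S_block t a" using assms(2) by (auto simp: \<pi> S_block_def)
    then have total: "sum a ?S = 2 * b"
      using assms(9) by (auto simp: hyperplane_group_def split: if_splits)
    have "num_fixed t a b \<pi> =
        card {A. A \<subseteq> ?S \<and> (\<forall>j\<in>?S. \<sigma> j \<in> A \<longleftrightarrow> j \<notin> A) \<and> sum a A = b}"
      using num_fixed_conv_card_sets[OF perm, of s False a b] sneg by (simp add: \<pi>)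
    also have "{A. A \<subseteq> ?S \<and> (\<forall>j\<in>?S. \<sigma> j \<in> A \<longleftrightarrow> j \<notin> A) \<and> sum a A = b} =
        {A. A \<subseteq> ?S \<and> (\<forall>j\<in>?S. \<sigma> j \<in> A \<longleftrightarrow> j \<notin> A)}"
    proof -
      have "sum a A = b" if "A \<subseteq> ?S" "\<forall>j\<in>?S. \<sigma> j \<in> A \<longleftrightarrow> j \<notin> A" for A
        using sum_alternating_set[OF perm fin _ that, of a] inv total by simp
      then show ?thesis by blast
    qed
    also have "card \<dots> = (if \<exists>C\<in>?P. odd (card C) then 0 else 2 ^ card ?P)"
      by (rule card_alternating_sets[OF perm fin])
    also have "\<dots> = no_odd_part \<mu> * 2 ^ size \<mu>"
    proof -
      have \<mu>: "\<mu> = (\<Sum>i=1..a t. image_mset card (mset_set (?B i)))"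
        unfolding assms(11) len by (intro sum.cong refl \<mu>s)
      have "set_mset \<mu> = card ` ?P"
        unfolding \<mu> P by (auto simp: set_mset_sum finB image_UN)
      \<comment> \<open>Unlike the set of parts, the number of parts counts multiplicities, so
        disjointness of the cycle families of different blocks enters here.\<close>
      moreover have "size \<mu> = card ?P"
      proof -
        have "size \<mu> = (\<Sum>i=1..a t. card (?B i))"
          unfolding \<mu> by (simp add: size_multiset_sum)
        also have "\<dots> = card ?P"
          unfolding P by (rule card_UN_disjoint[symmetric]) (use finB disj in auto)
        finally show ?thesis .
      qed
      ultimately show ?thesis by (simp add: no_odd_part_def)
    qed
    finally show "num_fixed t a b \<pi> = no_odd_part \<mu> * 2 ^ size \<mu>" .
  qed
qed

end
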